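(* Let $G$ be a finite simple graph (without node capacity constraints), and let $x^*(G)$ be its min-max star partitioning number. The following statements hold. (a) $x^*(G)\ge 1$ if and only if $G$ has at least one edge. (b) If $G$ is connected, then $x^*(G)\le 1$ if and only if $G$ is a cycle-free graph with diameter at most two. (c) If $G$ is a pseudoforest, i.e., each connected component of $G$ contains at most one cycle, then $x^*(G)\le 2$. (d) If $G=K_{n,n}$ is the complete bipartite graph with $n\in\mathbb{N}$, $n>1$, then $x^*(K_{n,n})=\left\lceil \frac n2\right\rceil+1$.
   Context: Let $G=(V,E)$ be a finite simple graph. Each node $v\in V$ has its own distinct color $C(v)$. A star coloring $C$ of $G$ assigns to each edge $e\in E$ a color $C(e)$ such that $C(e)=C(v)$ for some endpoint $v\in e$. When no node capacities are given, every star coloring is valid. For a star coloring $C$ and $v\in V$, let $x(G,C,v)=|\{C(e): e\in E,\ v\in e\}|$ be the number of different colors of edges incident to $v$, and let $x(G,C)=\max_{v\in V}x(G,C,v)$. The min-max star partitioning number is $x^*(G)=\min_C x(G,C)$, the minimum being over all star colorings $C$ of $G$. *)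

theory Defs
  imports Complex_Main "HOL-Library.Extended_Nat"
begin

section \<open>Finite simple graphs\<close>

locale finite_simple_graph =
  fixes V :: "'a set" and E :: "'a set set"
  assumes finite_nodes: "finite V"
    and edges: "\<And>e. e \<in> E \<Longrightarrow> e \<subseteq> V \<and> card e = 2"

text \<open>A walk is given by its nonempty list of nodes; it has one edge fewer than nodes.\<close>

definition walk :: "'a set \<Rightarrow> 'a set set \<Rightarrow> 'a list \<Rightarrow> bool" where
  "walk V E p \<longleftrightarrow> p \<noteq> [] \<and> set p \<subseteq> V \<and> successively (\<lambda>u v. {u, v} \<in> E) p"

definition walk_betw :: "'a set \<Rightarrow> 'a set set \<Rightarrow> 'a \<Rightarrow> 'a list \<Rightarrow> 'a \<Rightarrow> bool" where
  "walk_betw V E u p v \<longleftrightarrow> walk V E p \<and> hd p = u \<and> last p = v"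

definition graph_connected :: "'a set \<Rightarrow> 'a set set \<Rightarrow> bool" where
  "graph_connected V E \<longleftrightarrow> (\<forall>u\<in>V. \<forall>v\<in>V. \<exists>p. walk_betw V E u p v)"

text \<open>The distance is \<open>\<infinity>\<close> (the infimum of the empty set) between nodes that no walk joins.\<close>

definition graph_dist :: "'a set \<Rightarrow> 'a set set \<Rightarrow> 'a \<Rightarrow> 'a \<Rightarrow> enat" where
  "graph_dist V E u v = (INF p\<in>{p. walk_betw V E u p v}. enat (length p - 1))"

definition diameter :: "'a set \<Rightarrow> 'a set set \<Rightarrow> enat" where
  "diameter V E = (SUP (u, v)\<in>V \<times> V. graph_dist V E u v)"

text \<open>
  A cycle is a subgraph, represented by its edge set, so that rotations and reversals of the
  same node sequence are one cycle.
\<close>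

definition cycle_edges :: "'a list \<Rightarrow> 'a set set" where
  "cycle_edges p = {{p ! i, p ! (Suc i mod length p)} | i. i < length p}"

definition cycles :: "'a set \<Rightarrow> 'a set set \<Rightarrow> 'a set set set" where
  "cycles V E =
    {cycle_edges p | p. length p \<ge> 3 \<and> distinct p \<and> set p \<subseteq> V \<and> cycle_edges p \<subseteq> E}"

definition cycle_free :: "'a set \<Rightarrow> 'a set set \<Rightarrow> bool" where
  "cycle_free V E \<longleftrightarrow> cycles V E = {}"

definition components :: "'a set \<Rightarrow> 'a set set \<Rightarrow> 'a set set" where
  "components V E = {{v. \<exists>p. walk_betw V E u p v} | u. u \<in> V}"

definition induced_edges :: "'a set set \<Rightarrow> 'a set \<Rightarrow> 'a set set" where
  "induced_edges E K = {e \<in> E. e \<subseteq> K}"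

definition pseudoforest :: "'a set \<Rightarrow> 'a set set \<Rightarrow> bool" where
  "pseudoforest V E \<longleftrightarrow>
    (\<forall>K\<in>components V E. \<forall>F\<in>cycles K (induced_edges E K).
       \<forall>F'\<in>cycles K (induced_edges E K). F = F')"

definition complete_bipartite :: "nat \<Rightarrow> nat \<Rightarrow> 'a set \<Rightarrow> 'a set set \<Rightarrow> bool" where
  "complete_bipartite m n V E \<longleftrightarrow>
    (\<exists>A B. finite A \<and> finite B \<and> card A = m \<and> card B = n \<and> A \<inter> B = {} \<and> V = A \<union> B \<and>
       E = {{a, b} | a b. a \<in> A \<and> b \<in> B})"


section \<open>Star colorings\<close>

text \<open>
  Below, \<open>col\<close> is the fixed coloring of the nodes, assumed injective on \<open>V\<close> where it is used,
  and \<open>C\<close> is a coloring of the edges. Values of \<open>C\<close> outside \<open>E\<close> are irrelevant.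
\<close>

definition star_coloring :: "('a \<Rightarrow> 'c) \<Rightarrow> 'a set set \<Rightarrow> ('a set \<Rightarrow> 'c) \<Rightarrow> bool" where
  "star_coloring col E C \<longleftrightarrow> (\<forall>e\<in>E. \<exists>v\<in>e. C e = col v)"

definition colors_at :: "'a set set \<Rightarrow> ('a set \<Rightarrow> 'c) \<Rightarrow> 'a \<Rightarrow> nat" where
  "colors_at E C v = card {C e | e. e \<in> E \<and> v \<in> e}"

text \<open>
  On \<^typ>\<open>nat\<close>, the supremum of a finite nonempty set is its maximum and that of the empty set
  is \<open>0\<close>; the infimum of a nonempty set is its minimum.
\<close>

definition max_colors :: "'a set \<Rightarrow> 'a set set \<Rightarrow> ('a set \<Rightarrow> 'c) \<Rightarrow> nat" where
  "max_colors V E C = (SUP v\<in>V. colors_at E C v)"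

definition star_partitioning_number :: "('a \<Rightarrow> 'c) \<Rightarrow> 'a set \<Rightarrow> 'a set set \<Rightarrow> nat" where
  "star_partitioning_number col V E = (INF C\<in>{C. star_coloring col E C}. max_colors V E C)"

end

theory Submission imports Defs begin

text \<open>
  A star coloring amounts to the choice, for each edge, of one endpoint as its owner. A node
  then sees one color for all the edges that it owns, if it owns any, and one further color for
  each edge that it does not own, since the other endpoints of these edges are distinct.
  The theorem follows by counting foreign edges.

  Connected graphs with \<open>x\<^sup>* \<le> 1\<close>: if every node sees at most one color, colors spread along
  walks, so all edges carry the color of a single node \<open>c\<close> and hence contain \<open>c\<close>
  (\<open>one_color_per_node_imp_center\<close>). Having such a center is the same as being cycle-free with
  diameter at most two: a path on four nodes would either violate the diameter bound or close up
  to a cycle of length three, four or five, so any two edges meet, and pairwise meeting edges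
  form a star or a triangle (\<open>cycle_free_diameter_2_imp_center\<close>).

  Pseudoforests: if at most one edge at each node is foreign, every node sees at most two colors.
  The foreign ends thus have to form a system of distinct representatives of the edges. To find one
  (\<open>unicyclic_imp_system_of_representatives\<close>), loops \<open>{a}\<close> are admitted as edges and as cycles of
  length one. As long as a proper edge \<open>{a, b}\<close> is left, replacing it by one of the loops \<open>{a}\<close> and
  \<open>{b}\<close> keeps at most one cycle in each component (\<open>one_end_reaches_no_cycle\<close>). Once only loops
  are left, each is represented by its node, and a loop \<open>{a}\<close> that came from an edge hands its
  representative \<open>a\<close> back to that edge.

  \<open>K\<^bsub>n,n\<^esub>\<close>: for the upper bound, the owner of the edge between the \<open>i\<close>-th node on one side and the
  \<open>j\<close>-th on the other is chosen by the parity of \<open>i + j\<close>; every node then has at most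
  \<open>\<lceil>n / 2\<rceil>\<close> foreign edges. For the lower bound, if every node saw at most \<open>\<lceil>n / 2\<rceil>\<close> colors, then it
  would have fewer than \<open>n / 2\<close> foreign edges (\<open>foreign_edges_less_than_half\<close>); but each of the
  \<open>n\<^sup>2\<close> edges is foreign to one of its endpoints, and there are only \<open>2 n\<close> nodes.
\<close>

section \<open>The star partitioning number as a minimum\<close>

lemma finite_edges:
  assumes "finite_simple_graph V E"
  shows "finite E"
proof -
  interpret finite_simple_graph V E by fact
  have "E \<subseteq> Pow V" using edges by blast
  then show ?thesis using finite_nodes by (meson finite_Pow_iff finite_subset)
qed

lemma edgeE:
  assumes "finite_simple_graph V E" and "e \<in> E"
  obtains a b where "e = {a, b}" "a \<noteq> b" "a \<in> V" "b \<in> V"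
proof -
  have "e \<subseteq> V" "card e = 2" using finite_simple_graph.edges[OF assms] by auto
  then obtain a b where "e = {a, b}" "a \<noteq> b" by (meson card_2_iff)
  then show ?thesis using that \<open>e \<subseteq> V\<close> by blast
qed

lemma edgeD:
  assumes "finite_simple_graph V E" and "{a, b} \<in> E"
  shows "a \<in> V" "b \<in> V" "a \<noteq> b"
  using finite_simple_graph.edges[OF assms] by (auto simp: card_insert_if split: if_splits)

lemma edge_other_end:
  assumes "finite_simple_graph V E" and "e \<in> E" and "v \<in> e"
  obtains w where "e = {v, w}" "v \<noteq> w"
proof -
  obtain a b where ab: "e = {a, b}" "a \<noteq> b" using edgeE[OF assms(1,2)] .
  show ?thesis
  proof (cases "v = a")
    case True
    then show ?thesis using that[of b] ab by simp
  next
    case False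
    then show ?thesis using that[of a] ab assms(3) by (simp add: insert_commute)
  qed
qed

text \<open>
  The infimum over colorings and the supremum over nodes are taken on \<open>nat\<close>. The infimum is attained
  because some star coloring exists, and the supremum of the empty node set is \<open>0\<close>, so the
  equivalence holds for the empty graph as well. All later arguments use only this characterization.
\<close>

lemma star_partitioning_number_le_iff:
  assumes G: "finite_simple_graph V E"
  shows "star_partitioning_number col V E \<le> k \<longleftrightarrow>
    (\<exists>C. star_coloring col E C \<and> (\<forall>v\<in>V. colors_at E C v \<le> k))"
proof -
  have max_le: "max_colors V E C \<le> k \<longleftrightarrow> (\<forall>v\<in>V. colors_at E C v \<le> k)" for C
  proof (cases "V = {}")
    case True
    then show ?thesis by (simp add: max_colors_def)
  next
    case False
    have "bdd_above (colors_at E C ` V)"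
      using finite_simple_graph.finite_nodes[OF G] by simp
    then show ?thesis unfolding max_colors_def by (rule cSUP_le_iff[OF False])
  qed
  let ?S = "{C. star_coloring col E C}"
  have "star_coloring col E (\<lambda>e. col (SOME v. v \<in> e))"
    unfolding star_coloring_def
  proof
    fix e assume "e \<in> E"
    then obtain a b where "e = {a, b}" using edgeE[OF G] by metis
    then have "(SOME v. v \<in> e) \<in> e" by (metis insertI1 someI_ex)
    then show "\<exists>v\<in>e. col (SOME v. v \<in> e) = col v" by blast
  qed
  then have ne: "max_colors V E ` ?S \<noteq> {}" by blast
  have "star_partitioning_number col V E \<in> max_colors V E ` ?S"
    unfolding star_partitioning_number_def by (rule Inf_nat_def1[OF ne])
  moreover have "star_partitioning_number col V E \<le> max_colors V E C" if "C \<in> ?S" for C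
    unfolding star_partitioning_number_def using that by (intro cINF_lower) auto
  ultimately show ?thesis using max_le by (auto intro: order_trans)
qed

lemma same_color_at:
  assumes "finite E" "colors_at E C v \<le> 1" "e \<in> E" "f \<in> E" "v \<in> e" "v \<in> f"
  shows "C e = C f"
proof -
  have "{C e |e. e \<in> E \<and> v \<in> e} = C ` {e \<in> E. v \<in> e}" by auto
  then have "card (C ` {e \<in> E. v \<in> e}) \<le> Suc 0" using assms(2) by (simp add: colors_at_def)
  moreover have "finite (C ` {e \<in> E. v \<in> e})" using assms(1) by simp
  ultimately have "\<forall>x\<in>C ` {e \<in> E. v \<in> e}. \<forall>y\<in>C ` {e \<in> E. v \<in> e}. x = y"
    by (simp only: card_le_Suc0_iff_eq)
  then show ?thesis using assms(3-6) by blast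
qed

lemma star_partitioning_number_ge_1_iff:
  fixes col :: "'a \<Rightarrow> 'c"
  assumes G: "finite_simple_graph V E"
  shows "star_partitioning_number col V E \<ge> 1 \<longleftrightarrow> E \<noteq> {}"
proof -
  have nonzero: "colors_at E C a \<noteq> 0" if "e \<in> E" "a \<in> e" for C :: "'a set \<Rightarrow> 'c" and e a
    using that finite_edges[OF G] by (auto simp: colors_at_def)
  have "star_partitioning_number col V E \<le> 0 \<longleftrightarrow> E = {}"
  proof
    assume "star_partitioning_number col V E \<le> 0"
    then obtain C :: "'a set \<Rightarrow> 'c" where C: "\<forall>v\<in>V. colors_at E C v = 0"
      unfolding star_partitioning_number_le_iff[OF G] by auto
    show "E = {}"
    proof (rule equals0I)
      fix e assume e: "e \<in> E"
      then obtain a b where "e = {a, b}" "a \<in> V" by (rule edgeE[OF G])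
      then show False using nonzero[OF e, of a C] C by simp
    qed
  next
    assume "E = {}"
    then show "star_partitioning_number col V E \<le> 0"
      unfolding star_partitioning_number_le_iff[OF G] by (simp add: star_coloring_def colors_at_def)
  qed
  then show ?thesis by (cases "E = {}") auto
qed

section \<open>Reachability, paths and cycles\<close>

text \<open>
  Adjacency and reachability refer to an edge set alone. This lets edges be removed, or replaced by
  loops \<open>{u}\<close> (for which \<open>u\<close> is adjacent to itself), without tracking a node set.
\<close>

abbreviation adjacent :: "'a set set \<Rightarrow> 'a \<Rightarrow> 'a \<Rightarrow> bool" where
  "adjacent F u v \<equiv> {u, v} \<in> F"

abbreviation reachable :: "'a set set \<Rightarrow> 'a \<Rightarrow> 'a \<Rightarrow> bool" where
  "reachable F \<equiv> (adjacent F)\<^sup>*\<^sup>*"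

lemma reachable_sym: "reachable F u v \<Longrightarrow> reachable F v u"
  by (rule sympD[OF symp_rtranclp]) (auto simp: symp_def insert_commute)

lemma reachable_mono: "F \<subseteq> F' \<Longrightarrow> reachable F u v \<Longrightarrow> reachable F' u v"
  by (erule rtranclp_mono[THEN predicate2D, rotated]) auto

lemma successively_imp_reachable:
  assumes "successively (adjacent F) p" "p \<noteq> []"
  shows "reachable F (hd p) (last p)"
  using assms
proof (induction p rule: induct_list012)
  case (3 x y zs)
  then show ?case by (auto intro: converse_rtranclp_into_rtranclp)
qed auto

lemma walk_betw_iff_reachable:
  assumes G: "finite_simple_graph V E" and u: "u \<in> V"
  shows "(\<exists>p. walk_betw V E u p v) \<longleftrightarrow> reachable E u v"
proof
  assume "\<exists>p. walk_betw V E u p v"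
  then show "reachable E u v"
    by (auto simp: walk_betw_def walk_def dest: successively_imp_reachable)
next
  assume "reachable E u v"
  then show "\<exists>p. walk_betw V E u p v"
  proof induction
    case base
    have "walk_betw V E u [u] u" using u by (simp add: walk_betw_def walk_def)
    then show ?case by blast
  next
    case (step v w)
    then obtain p where "walk_betw V E u p v" by blast
    then have "walk_betw V E u (p @ [w]) w"
      using step.hyps edgeD[OF G step.hyps(2)]
      by (auto simp: walk_betw_def walk_def successively_append_iff)
    then show ?case by blast
  qed
qed

lemma reachable_simple_path:
  assumes "reachable F a b"
  obtains p where "p \<noteq> []" "hd p = a" "last p = b" "distinct p" "successively (adjacent F) p"
proof -
  have "\<exists>p. p \<noteq> [] \<and> hd p = a \<and> last p = b \<and> distinct p \<and> successively (adjacent F) p"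
    using assms
  proof induction
    case base
    show ?case by (rule exI[of _ "[a]"]) simp
  next
    case (step b c)
    then obtain p where p: "p \<noteq> []" "hd p = a" "last p = b" "distinct p"
      "successively (adjacent F) p" by blast
    show ?case
    proof (cases "c \<in> set p")
      case False
      then show ?thesis using p step.hyps
        by (intro exI[of _ "p @ [c]"]) (auto simp: successively_append_iff)
    next
      case True
      then obtain q r where "p = q @ c # r" by (meson split_list)
      then show ?thesis using p
        by (intro exI[of _ "q @ [c]"]) (auto simp: successively_append_iff hd_append)
    qed
  qed
  then show ?thesis using that by blast
qed

lemma Union_cycle_edges: "\<Union> (cycle_edges p) = set p"
proof
  show "\<Union> (cycle_edges p) \<subseteq> set p"
  proof
    fix x assume "x \<in> \<Union> (cycle_edges p)"
    then obtain i where i: "i < length p" "x = p ! i \<or> x = p ! (Suc i mod length p)"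
      by (auto simp: cycle_edges_def)
    then have "Suc i mod length p < length p" by (intro mod_less_divisor) linarith
    then show "x \<in> set p" using i by auto
  qed
  show "set p \<subseteq> \<Union> (cycle_edges p)"
  proof
    fix x assume "x \<in> set p"
    then obtain i where "i < length p" "x = p ! i" by (metis in_set_conv_nth)
    then have "{p ! i, p ! (Suc i mod length p)} \<in> cycle_edges p" "x \<in> {p ! i, p ! (Suc i mod length p)}"
      by (auto simp: cycle_edges_def)
    then show "x \<in> \<Union> (cycle_edges p)" by (rule UnionI)
  qed
qed

lemma reachable_on_cycle:
  assumes "cycle_edges p \<subseteq> F" "x \<in> set p"
  shows "reachable F (hd p) x"
proof -
  have "reachable F (p ! 0) (p ! i)" if "i < length p" for i
    using that
  proof (induction i)
    case (Suc i)
    have "{p ! i, p ! (Suc i mod length p)} \<in> cycle_edges p"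
      using Suc.prems unfolding cycle_edges_def by (auto intro!: exI[of _ i])
    then have "adjacent F (p ! i) (p ! Suc i)" using Suc.prems assms(1) by auto
    then show ?case using Suc by (auto intro: rtranclp.rtrancl_into_rtrancl)
  qed simp
  then show ?thesis using assms(2) by (metis hd_conv_nth in_set_conv_nth list.set_cases neq_Nil_conv)
qed

text \<open>
  The only edge of the closed sequence that is possibly not in \<open>F\<close> is the closing one. It is put into
  the bound explicitly so that the statement applies both when the closing edge is in the
  graph and when it is just about to be added.
\<close>

lemma cycle_edges_close_path:
  assumes "successively (adjacent F) p" "p \<noteq> []"
  shows "cycle_edges p \<subseteq> insert {last p, hd p} F" and "{last p, hd p} \<in> cycle_edges p"
proof -
  have "{p ! i, p ! (Suc i mod length p)} \<in> insert {last p, hd p} F" if "i < length p" for i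
  proof (cases "Suc i = length p")
    case True
    then have "p ! i = last p" using assms(2) by (metis diff_Suc_1 last_conv_nth)
    then show ?thesis using True assms(2) by (simp add: hd_conv_nth)
  next
    case False
    then show ?thesis using that assms(1) by (simp add: successively_conv_nth)
  qed
  then show "cycle_edges p \<subseteq> insert {last p, hd p} F" by (auto simp: cycle_edges_def)
  have "{p ! (length p - 1), p ! (Suc (length p - 1) mod length p)} \<in> cycle_edges p"
    using assms(2) unfolding cycle_edges_def
    by (metis (mono_tags, lifting) diff_less length_greater_0_conv less_one mem_Collect_eq)
  then show "{last p, hd p} \<in> cycle_edges p"
    using assms(2) by (simp add: hd_conv_nth last_conv_nth)
qed

lemma cycle_freeD:
  assumes "finite_simple_graph V E" "cycle_free V E"
    and "successively (adjacent E) p" "adjacent E (last p) (hd p)" "distinct p" "length p \<ge> 3"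
  shows False
proof -
  have "p \<noteq> []" using assms(6) by auto
  then have sub: "cycle_edges p \<subseteq> E" using cycle_edges_close_path(1)[OF assms(3)] assms(4) by auto
  moreover have "set p \<subseteq> V"
    using sub Union_cycle_edges[of p] finite_simple_graph.edges[OF assms(1)] by blast
  ultimately have "cycle_edges p \<in> cycles V E" using assms by (auto simp: cycles_def)
  then show False using assms(2) by (simp add: cycle_free_def)
qed

section \<open>Cycle-free connected graphs of diameter at most two\<close>

lemma graph_dist_le_2_iff:
  "graph_dist V E u v \<le> 2 \<longleftrightarrow> (\<exists>p. walk_betw V E u p v \<and> length p \<le> 3)"
proof -
  have "graph_dist V E u v \<le> 2 \<longleftrightarrow> graph_dist V E u v < enat 3"
    by (cases "graph_dist V E u v") (auto simp: numeral_eq_enat)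
  also have "\<dots> \<longleftrightarrow> (\<exists>p. walk_betw V E u p v \<and> enat (length p - 1) < enat 3)"
    unfolding graph_dist_def by (subst INF_less_iff) simp
  also have "\<dots> \<longleftrightarrow> (\<exists>p. walk_betw V E u p v \<and> length p \<le> 3)"
    by (rule arg_cong[where f = Ex]) auto
  finally show ?thesis .
qed

lemma diameter_le_2_iff:
  "diameter V E \<le> 2 \<longleftrightarrow> (\<forall>u\<in>V. \<forall>v\<in>V. \<exists>p. walk_betw V E u p v \<and> length p \<le> 3)"
  by (auto simp: diameter_def SUP_le_iff graph_dist_le_2_iff)

lemma diameter_le_2_cases:
  assumes "diameter V E \<le> 2" "u \<in> V" "v \<in> V"
  obtains "u = v" | "adjacent E u v" | w where "adjacent E u w" "adjacent E w v"
proof -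
  obtain p where p: "walk_betw V E u p v" "length p \<le> 3"
    using assms by (auto simp: diameter_le_2_iff)
  then consider "p = [u]" "u = v" | "p = [u, v]" | w where "p = [u, w, v]"
    by (cases p; cases "tl p"; cases "tl (tl p)")
      (auto simp: walk_betw_def walk_def split: if_splits)
  then show ?thesis using that p by cases (auto simp: walk_betw_def walk_def)
qed

text \<open>
  The ends \<open>w\<close> and \<open>z\<close> of the path are equal, adjacent or have a common neighbour \<open>t\<close>. An edge between
  them closes a cycle of length four; a common neighbour gives a triangle if it is an
  inner node of the path, and a cycle of length five otherwise.
\<close>

lemma no_path_of_four_nodes:
  assumes G: "finite_simple_graph V E" and cf: "cycle_free V E" and d: "diameter V E \<le> 2"
    and e: "adjacent E w x" "adjacent E x y" "adjacent E y z" and dist: "distinct [w, x, y, z]"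
  shows False
proof -
  note cyc = cycle_freeD[OF G cf]
  have "w \<in> V" "z \<in> V" using edgeD[OF G] e by auto
  with d show False
  proof (cases rule: diameter_le_2_cases)
    case 1
    then show False using dist by simp
  next
    case 2
    then show False using cyc[of "[w, x, y, z]"] e dist by (simp add: insert_commute)
  next
    case (3 t)
    have t: "t \<noteq> w" "t \<noteq> z" using edgeD(3)[OF G 3(1)] edgeD(3)[OF G 3(2)] by auto
    consider "t = x" | "t = y" | "t \<noteq> x" "t \<noteq> y" by blast
    then show False
    proof cases
      case 1
      then show False using cyc[of "[x, y, z]"] 3 e dist by (simp add: insert_commute)
    next
      case 2
      then show False using cyc[of "[w, x, y]"] 3 e dist by (simp add: insert_commute)
    next
      case _: 3
      then show False using cyc[of "[w, x, y, z, t]"] 3 e dist t by (auto simp: insert_commute)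
    qed
  qed
qed

text \<open>
  The ends \<open>a\<close> and \<open>c\<close> are joined by at most two edges, and these together with \<open>{a, b}\<close> and \<open>{c, d}\<close>
  contain a path on four nodes.
\<close>

lemma disjoint_edges_impossible:
  assumes G: "finite_simple_graph V E" and cf: "cycle_free V E" and d: "diameter V E \<le> 2"
    and e: "adjacent E a b" "adjacent E c d" and disj: "{a, b} \<inter> {c, d} = {}"
  shows False
proof -
  note P4 = no_path_of_four_nodes[OF G cf d]
  have V: "a \<in> V" "c \<in> V" "a \<noteq> b" "c \<noteq> d" using edgeD[OF G] e by auto
  from d V(1,2) show False
  proof (cases rule: diameter_le_2_cases)
    case 1
    then show False using disj by simp
  next
    case 2
    then show False using P4[of b a c d] e disj V by (auto simp: insert_commute)
  next
    case (3 t)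
    have t: "t \<noteq> a" "t \<noteq> c" using edgeD(3)[OF G 3(1)] edgeD(3)[OF G 3(2)] by auto
    consider "t = b" | "t = d" | "t \<noteq> b" "t \<noteq> d" by blast
    then show False
    proof cases
      case 1
      then show False using P4[of a b c d] 3 e disj V by (auto simp: insert_commute)
    next
      case 2
      then show False using P4[of b a d c] 3 e disj V by (auto simp: insert_commute)
    next
      case _: 3
      then show False using P4[of b a t c] 3 e disj V t by (auto simp: insert_commute)
    qed
  qed
qed

text \<open>
  Pairwise meeting edges without a common node form a triangle: if \<open>e\<close> avoids \<open>a\<close> and \<open>f\<close>
  avoids \<open>b\<close>, then meeting \<open>{a, b}\<close> forces \<open>e = {b, x}\<close> and \<open>f = {a, y}\<close>, and \<open>x = y\<close> because
  \<open>e\<close> meets \<open>f\<close>.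
\<close>

lemma cycle_free_diameter_2_imp_center:
  assumes G: "finite_simple_graph V E" and cf: "cycle_free V E" and d: "diameter V E \<le> 2"
  shows "\<exists>c. \<forall>e\<in>E. c \<in> e"
proof (cases "E = {}")
  case False
  have meet: "e \<inter> f \<noteq> {}" if "e \<in> E" "f \<in> E" for e f
    using that disjoint_edges_impossible[OF G cf d] by (metis edgeE[OF G])
  obtain a b where ab: "adjacent E a b" using False by (metis all_not_in_conv edgeE[OF G])
  show ?thesis
  proof (rule ccontr)
    assume "\<nexists>c. \<forall>e\<in>E. c \<in> e"
    then obtain e f where e: "e \<in> E" "a \<notin> e" and f: "f \<in> E" "b \<notin> f" by metis
    have "b \<in> e" "a \<in> f" using meet[OF ab e(1)] meet[OF ab f(1)] e f by auto
    obtain x where x: "e = {b, x}" using edge_other_end[OF G e(1) \<open>b \<in> e\<close>] .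
    obtain y where y: "f = {a, y}" using edge_other_end[OF G f(1) \<open>a \<in> f\<close>] .
    have "x = y" using meet[OF e(1) f(1)] x y e f by auto
    then show False
      using cycle_freeD[OF G cf, of "[a, b, x]"] ab e f x y edgeD[OF G] by (auto simp: insert_commute)
  qed
qed simp

text \<open>
  Of the first two edges of a cycle, \<open>c\<close> is the common node; but the third edge, which in a
  triangle leads back to the first node, avoids it.
\<close>

lemma center_imp_cycle_free:
  assumes c: "\<forall>e\<in>E. c \<in> e"
  shows "cycle_free V E"
proof -
  have False if p: "length p \<ge> 3" "distinct p" "cycle_edges p \<subseteq> E" for p :: "'a list"
  proof -
    have in_E: "{p ! i, p ! (Suc i mod length p)} \<in> E" if "i < length p" for i
      using p that by (auto simp: cycle_edges_def)
    have c: "c = p ! i \<or> c = p ! (Suc i mod length p)" if "i < length p" for i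
      using bspec[OF c in_E[OF that]] by simp
    let ?j = "Suc 2 mod length p"
    have mods: "Suc 0 mod length p = 1" "Suc 1 mod length p = 2" "?j \<noteq> 1" "?j < length p"
      using p(1) by (cases "length p = 3"; simp)+
    have neq: "p ! i \<noteq> p ! j" if "i < length p" "j < length p" "i \<noteq> j" for i j
      using nth_eq_iff_index_eq[OF p(2)] that by simp
    have len: "0 < length p" "1 < length p" "2 < length p" using p(1) by linarith+
    have "c = p ! 1"
      using c[OF len(1), unfolded mods] c[OF len(2), unfolded mods] neq[OF len(1,3)] by auto
    then show False
      using c[OF len(3)] neq[OF len(2,3)] neq[OF len(2) mods(4)] mods(3) by auto
  qed
  then show ?thesis by (auto simp: cycle_free_def cycles_def)
qed

lemma center_imp_diameter_le_2:
  assumes G: "finite_simple_graph V E" and conn: "graph_connected V E" and c: "\<forall>e\<in>E. c \<in> e"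
  shows "diameter V E \<le> 2"
  unfolding diameter_le_2_iff
proof (intro ballI)
  fix u v assume uv: "u \<in> V" "v \<in> V"
  have adj: "adjacent E x c" if xy: "x \<in> V" "y \<in> V" "x \<noteq> y" "x \<noteq> c" for x y
  proof -
    have "reachable E x y"
      using conn xy walk_betw_iff_reachable[OF G] by (auto simp: graph_connected_def)
    then obtain z where "adjacent E x z" using xy(3) by (cases rule: converse_rtranclpE) auto
    moreover from bspec[OF c this] have "z = c" using xy(4) by simp
    ultimately show ?thesis by simp
  qed
  consider "u = v" | "u \<noteq> v" "u = c" | "u \<noteq> v" "v = c" | "u \<noteq> v" "u \<noteq> c" "v \<noteq> c" by blast
  then show "\<exists>p. walk_betw V E u p v \<and> length p \<le> 3"
  proof cases
    case 1
    then show ?thesis using uv by (intro exI[of _ "[u]"]) (simp add: walk_betw_def walk_def)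
  next
    case 2
    then show ?thesis using uv adj[of v u]
      by (intro exI[of _ "[u, v]"]) (auto simp: walk_betw_def walk_def insert_commute)
  next
    case 3
    then show ?thesis using uv adj[of u v]
      by (intro exI[of _ "[u, v]"]) (auto simp: walk_betw_def walk_def insert_commute)
  next
    case 4
    then show ?thesis using uv adj[of u v] adj[of v u] edgeD[OF G, of u c]
      by (intro exI[of _ "[u, c, v]"]) (auto simp: walk_betw_def walk_def insert_commute)
  qed
qed

text \<open>
  The color of one edge spreads to all edges because consecutive edges of a walk share a node.
  Injectivity of the node colors turns equal colors into a common endpoint.
\<close>

lemma one_color_per_node_imp_center:
  assumes G: "finite_simple_graph V E" and inj: "inj_on col V" and conn: "graph_connected V E"
    and C: "star_coloring col E C" and le: "\<forall>v\<in>V. colors_at E C v \<le> 1"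
  shows "\<exists>c. \<forall>e\<in>E. c \<in> e"
proof (cases "E = {}")
  case False
  then obtain f where f: "f \<in> E" by blast
  then obtain c where c: "c \<in> f" "C f = col c" using C by (auto simp: star_coloring_def)
  have cV: "c \<in> V" using c f finite_simple_graph.edges[OF G] by blast
  have same: "C e = C e'" if "e \<in> E" "e' \<in> E" "v \<in> e" "v \<in> e'" for e e' v
    using same_color_at[OF finite_edges[OF G]] le that finite_simple_graph.edges[OF G] by blast
  have spread: "\<forall>e\<in>E. x \<in> e \<longrightarrow> C e = col c" if "reachable E c x" for x
    using that
  proof induction
    case base
    then show ?case using same f c by metis
  next
    case (step y z)
    have "C {y, z} = col c" using step by blast
    then show ?case using same step.hyps by (metis insertCI)
  qed
  have "c \<in> e" if e: "e \<in> E" for e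
  proof -
    obtain v where v: "v \<in> e" "C e = col v" using C e by (auto simp: star_coloring_def)
    have "v \<in> V" using v e finite_simple_graph.edges[OF G] by blast
    moreover from this have "reachable E c v"
      using conn cV walk_betw_iff_reachable[OF G cV] by (auto simp: graph_connected_def)
    then have "col v = col c" using spread e v by metis
    ultimately show ?thesis using inj cV v by (metis inj_onD)
  qed
  then show ?thesis by blast
qed simp

lemma center_imp_star_partitioning_number_le_1:
  assumes G: "finite_simple_graph V E" and c: "\<forall>e\<in>E. c \<in> e"
  shows "star_partitioning_number col V E \<le> 1"
  unfolding star_partitioning_number_le_iff[OF G]
proof (intro exI conjI ballI)
  show "star_coloring col E (\<lambda>_. col c)" using c by (auto simp: star_coloring_def)
  show "colors_at E (\<lambda>_. col c) v \<le> 1" for v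
  proof -
    have "{col c |e. e \<in> E \<and> v \<in> e} \<subseteq> {col c}" by blast
    from card_mono[OF _ this] show ?thesis by (simp add: colors_at_def)
  qed
qed

lemma star_partitioning_number_le_1_iff:
  assumes G: "finite_simple_graph V E" and inj: "inj_on col V" and conn: "graph_connected V E"
  shows "star_partitioning_number col V E \<le> 1 \<longleftrightarrow> cycle_free V E \<and> diameter V E \<le> 2"
proof
  assume "star_partitioning_number col V E \<le> 1"
  then obtain c where c: "\<forall>e\<in>E. c \<in> e"
    unfolding star_partitioning_number_le_iff[OF G]
    using one_color_per_node_imp_center[OF G inj conn] by blast
  show "cycle_free V E \<and> diameter V E \<le> 2"
    using center_imp_cycle_free[OF c] center_imp_diameter_le_2[OF G conn c] by simp
next
  assume "cycle_free V E \<and> diameter V E \<le> 2"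
  then show "star_partitioning_number col V E \<le> 1"
    using cycle_free_diameter_2_imp_center[OF G] center_imp_star_partitioning_number_le_1[OF G]
    by blast
qed

section \<open>Pseudoforests\<close>

text \<open>
  Sequences of length one are admitted, so a loop \<open>{a}\<close> counts as a cycle. Length two is excluded
  because the closed sequence \<open>[a, b]\<close> traverses a single edge twice.
\<close>

definition is_cycle :: "'a set set \<Rightarrow> 'a list \<Rightarrow> bool" where
  "is_cycle F p \<longleftrightarrow> p \<noteq> [] \<and> length p \<noteq> 2 \<and> distinct p \<and> cycle_edges p \<subseteq> F"

definition unicyclic :: "'a set set \<Rightarrow> bool" where
  "unicyclic F \<longleftrightarrow> (\<forall>p q. is_cycle F p \<longrightarrow> is_cycle F q \<longrightarrow> reachable F (hd p) (hd q) \<longrightarrow>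
     cycle_edges p = cycle_edges q)"

lemma unicyclicD:
  assumes "unicyclic F" "is_cycle F p" "is_cycle F q" "reachable F (hd p) (hd q)"
  shows "cycle_edges p = cycle_edges q"
  using assms(1)[unfolded unicyclic_def, rule_format, OF assms(2-4)] .

lemma cycle_edges_singleton: "cycle_edges [x] = {{x}}"
  by (simp add: cycle_edges_def)

lemma is_cycle_mono: "is_cycle F p \<Longrightarrow> F \<subseteq> F' \<Longrightarrow> is_cycle F' p"
  unfolding is_cycle_def by (metis order_trans)

text \<open>
  An edge of a cycle that is a loop joins some position to the next one; as the nodes are distinct,
  these positions coincide, and the cycle has length one.
\<close>

lemma is_cycle_insert_loop:
  assumes "is_cycle (insert {a} F) p" "\<not> is_cycle F p"
  shows "p = [a]"
proof -
  have p: "p \<noteq> []" "length p \<noteq> 2" "distinct p" "cycle_edges p \<subseteq> insert {a} F"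
    using assms(1) by (auto simp: is_cycle_def)
  have "{a} \<in> cycle_edges p" using assms by (auto simp: is_cycle_def)
  then obtain i where i: "i < length p" "{a} = {p ! i, p ! (Suc i mod length p)}"
    by (auto simp: cycle_edges_def)
  then have "p ! i = p ! (Suc i mod length p)" by (metis doubleton_eq_iff insert_absorb2)
  then have "i = Suc i mod length p"
    using p i nth_eq_iff_index_eq[OF p(3) i(1), of "Suc i mod length p"] by auto
  then have "length p = 1"
    using i(1) by (cases "Suc i = length p") auto
  then show ?thesis using i by (cases p) auto
qed

lemma reachable_insert_loop: "reachable (insert {a} F) u v \<longleftrightarrow> reachable F u v"
proof
  assume "reachable (insert {a} F) u v"
  then show "reachable F u v"
  proof induction
    case (step y z)
    show ?case
    proof (cases "y = z")
      case False
      then have "adjacent F y z" using step.hyps(2) by auto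
      with step.IH show ?thesis by (rule rtranclp.rtrancl_into_rtrancl)
    qed (use step in simp)
  qed simp
qed (rule reachable_mono, auto)

lemma unicyclic_insert_loop:
  assumes F: "unicyclic F" and a: "\<And>p. is_cycle F p \<Longrightarrow> \<not> reachable F a (hd p)"
  shows "unicyclic (insert {a} F)"
  unfolding unicyclic_def reachable_insert_loop
proof (intro allI impI)
  fix p q
  assume "is_cycle (insert {a} F) p" "is_cycle (insert {a} F) q" and r: "reachable F (hd p) (hd q)"
  then have "is_cycle F p \<or> p = [a]" "is_cycle F q \<or> q = [a]"
    using is_cycle_insert_loop[of a F p] is_cycle_insert_loop[of a F q] by argo+
  then consider "is_cycle F p" "is_cycle F q" | "is_cycle F p" "q = [a]"
    | "p = [a]" "is_cycle F q" | "p = [a]" "q = [a]"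
    by argo
  then show "cycle_edges p = cycle_edges q"
  proof cases
    case 1
    then show ?thesis using r by (rule unicyclicD[OF F])
  next
    case 2
    then show ?thesis using a[of p] reachable_sym[OF r] by simp
  next
    case 3
    then show ?thesis using a[of q] r by simp
  next
    case 4
    then show ?thesis by simp
  qed
qed

lemma unicyclic_mono:
  assumes F': "unicyclic F'" and sub: "F \<subseteq> F'"
  shows "unicyclic F"
  unfolding unicyclic_def
proof (intro allI impI)
  fix p q
  assume p: "is_cycle F p" and q: "is_cycle F q" and r: "reachable F (hd p) (hd q)"
  show "cycle_edges p = cycle_edges q"
    by (rule unicyclicD[OF F' is_cycle_mono[OF p sub] is_cycle_mono[OF q sub] reachable_mono[OF sub r]])
qed

text \<open>
  Suppose that after removing \<open>{a, b}\<close> each end still reaches a cycle. The edge joins the two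
  components, so both cycles are the same one, and \<open>a\<close> and \<open>b\<close> are connected without the edge.
  A simple path between them is closed by the edge to another cycle in the component: it contains
  \<open>{a, b}\<close>, the first one does not.
\<close>

lemma one_end_reaches_no_cycle:
  assumes F: "unicyclic F" and e: "{a, b} \<in> F" "a \<noteq> b"
    and p: "is_cycle (F - {{a, b}}) p" "reachable (F - {{a, b}}) a (hd p)"
    and q: "is_cycle (F - {{a, b}}) q" "reachable (F - {{a, b}}) b (hd q)"
  shows False
proof -
  let ?F = "F - {{a, b}}"
  have mono: "reachable F u v" if "reachable ?F u v" for u v
    using reachable_mono[OF _ that] by blast
  have cyc: "is_cycle F p" "is_cycle F q" using p q is_cycle_mono by blast+
  have "reachable F (hd p) b"
    using mono[OF reachable_sym[OF p(2)]] e(1) by (rule rtranclp.rtrancl_into_rtrancl)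
  then have "reachable F (hd p) (hd q)" using mono[OF q(2)] by (rule rtranclp_trans)
  then have "cycle_edges p = cycle_edges q" by (rule unicyclicD[OF F cyc])
  then have "hd p \<in> set q"
    using p(1) Union_cycle_edges by (metis is_cycle_def list.set_sel(1))
  then have "reachable ?F (hd q) (hd p)"
    using q(1) by (intro reachable_on_cycle) (auto simp: is_cycle_def)
  then have "reachable ?F b a" using q(2) reachable_sym[OF p(2)] by (meson rtranclp_trans)
  then obtain r where r: "r \<noteq> []" "hd r = b" "last r = a" "distinct r" "successively (adjacent ?F) r"
    by (rule reachable_simple_path)
  note close = cycle_edges_close_path[OF r(5,1)]
  have "length r \<noteq> 2"
  proof
    assume "length r = 2"
    then obtain x y where "r = [x, y]" by (auto simp: length_Suc_conv numeral_2_eq_2)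
    then show False using r by (auto simp: insert_commute)
  qed
  then have "is_cycle F r" using close(1) r e by (auto simp: is_cycle_def)
  moreover have "reachable F (hd p) (hd r)" using \<open>reachable F (hd p) b\<close> r(2) by simp
  ultimately have "cycle_edges p = cycle_edges r" by (rule unicyclicD[OF F cyc(1)])
  then have "{a, b} \<in> cycle_edges p" using close(2) r by simp
  then show False using p(1) by (auto simp: is_cycle_def)
qed

text \<open>
  Induction on the number of proper edges. A proper edge \<open>e\<close> is replaced by the loop at an end
  \<open>a\<close> that reaches no cycle without \<open>e\<close>. In the smaller graph \<open>a\<close> represents its own loop, hence no
  other edge, so it is free to represent \<open>e\<close>.
\<close>

lemma unicyclic_imp_system_of_representatives:
  assumes "finite F" "unicyclic F" "\<forall>e\<in>F. card e = 1 \<or> card e = 2"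
  shows "\<exists>g. inj_on g F \<and> (\<forall>e\<in>F. g e \<in> e)"
  using assms
proof (induction "card {e \<in> F. card e = 2}" arbitrary: F rule: less_induct)
  case less
  show ?case
  proof (cases "\<exists>e\<in>F. card e = 2")
    case False
    have loop: "e = {the_elem e}" if "e \<in> F" for e
    proof -
      have "card e = 1" using False less.prems(3) that by blast
      then show ?thesis by (auto simp: card_1_singleton_iff)
    qed
    have "inj_on the_elem F" by (rule inj_onI) (metis loop)
    moreover have "\<forall>e\<in>F. the_elem e \<in> e" using loop by blast
    ultimately show ?thesis by blast
  next
    case True
    then obtain e where e: "e \<in> F" "card e = 2" by blast
    let ?F = "F - {e}"
    have "\<exists>a\<in>e. \<forall>p. is_cycle ?F p \<longrightarrow> \<not> reachable ?F a (hd p)"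
    proof -
      obtain a b where ab: "e = {a, b}" "a \<noteq> b" using e by (meson card_2_iff)
      show ?thesis
        using one_end_reaches_no_cycle[OF less.prems(2), of a b] e ab by auto
    qed
    then obtain a where a: "a \<in> e" "\<And>p. is_cycle ?F p \<Longrightarrow> \<not> reachable ?F a (hd p)" by blast
    let ?F' = "insert {a} ?F"
    \<comment> \<open>Otherwise \<open>a\<close> would reach the cycle \<open>[a]\<close>. So \<open>{a}\<close> and the remaining edges have different representatives.\<close>
    have "{a} \<notin> ?F"
    proof
      assume "{a} \<in> ?F"
      then have "is_cycle ?F [a]" by (simp add: is_cycle_def cycle_edges_singleton)
      then show False using a(2) by fastforce
    qed
    have "unicyclic ?F'"
      using unicyclic_insert_loop[OF unicyclic_mono[OF less.prems(2)]] a(2) by blast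
    moreover have "card {f \<in> ?F'. card f = 2} < card {f \<in> F. card f = 2}"
    proof -
      have fin: "finite {f \<in> F. card f = 2}" using less.prems(1) by simp
      have "{f \<in> ?F'. card f = 2} \<subseteq> {f \<in> F. card f = 2} - {e}" by auto
      then have "card {f \<in> ?F'. card f = 2} \<le> card ({f \<in> F. card f = 2} - {e})"
        using fin by (intro card_mono) simp_all
      also have "\<dots> < card {f \<in> F. card f = 2}" using fin e by (intro card_Diff1_less) simp_all
      finally show ?thesis .
    qed
    moreover have "finite ?F'" "\<forall>f\<in>?F'. card f = 1 \<or> card f = 2" using less.prems(1,3) by auto
    ultimately obtain g where g: "inj_on g ?F'" "\<forall>f\<in>?F'. g f \<in> f"
      using less.hyps[of ?F'] by blast
    have ga: "g {a} = a" using bspec[OF g(2), of "{a}"] by simp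
    have "a \<notin> g ` ?F"
    proof
      assume "a \<in> g ` ?F"
      then obtain f where f: "f \<in> ?F" "g f = g {a}" using ga by auto
      then have "f = {a}" by (intro inj_onD[OF g(1)]) simp_all
      then show False using f(1) \<open>{a} \<notin> ?F\<close> by simp
    qed
    moreover have "inj_on g ?F" using g(1) by (rule inj_on_subset) blast
    ultimately have "inj_on (g(e := a)) F"
      using e(1) inj_on_fun_updI[of g ?F a e] inj_on_insert[of "g(e := a)" e ?F]
      by (simp add: insert_absorb)
    moreover have "\<forall>f\<in>F. (g(e := a)) f \<in> f" using g(2) a(1) by simp
    ultimately show ?thesis by blast
  qed
qed

text \<open>
  A simple graph has no loops, so its cycles in the wider sense are the usual ones, and each cycle
  lies in the component of any node from which it can be reached.
\<close>

lemma pseudoforest_imp_unicyclic: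
  assumes G: "finite_simple_graph V E" and pf: "pseudoforest V E"
  shows "unicyclic E"
  unfolding unicyclic_def
proof (intro allI impI)
  fix p q
  assume p: "is_cycle E p" and q: "is_cycle E q" and r: "reachable E (hd p) (hd q)"
  let ?K = "{v. \<exists>w. walk_betw V E (hd p) w v}"
  have subV: "set s \<subseteq> V" if "is_cycle E s" for s
    using that Union_cycle_edges[of s] finite_simple_graph.edges[OF G] unfolding is_cycle_def by blast
  have len: "length s \<ge> 3" if "is_cycle E s" for s
  proof -
    have "length s \<noteq> 1"
    proof
      assume "length s = 1"
      then obtain x where "s = [x]" by (auto simp: length_Suc_conv)
      then have "{x, x} \<in> E" using that by (simp add: is_cycle_def cycle_edges_singleton)
      then show False using edgeD(3)[OF G] by blast
    qed
    moreover have "length s \<noteq> 0" "length s \<noteq> 2" using that by (auto simp: is_cycle_def)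
    ultimately show ?thesis by linarith
  qed
  have hd: "hd p \<in> V" using p subV[OF p] by (auto simp: is_cycle_def)
  then have K: "?K \<in> components V E" by (auto simp: components_def)
  have inK: "cycle_edges s \<in> cycles ?K (induced_edges E ?K)"
    if s: "is_cycle E s" and hs: "reachable E (hd p) (hd s)" for s
  proof -
    have "set s \<subseteq> ?K"
      using reachable_on_cycle[of s E] s hs rtranclp_trans[OF hs]
      by (auto simp: is_cycle_def walk_betw_iff_reachable[OF G hd])
    moreover from this have "cycle_edges s \<subseteq> induced_edges E ?K"
      using s Union_cycle_edges[of s] unfolding is_cycle_def induced_edges_def by blast
    ultimately show ?thesis using s len[OF s] by (auto simp: cycles_def is_cycle_def)
  qed
  show "cycle_edges p = cycle_edges q"
    using pf K inK[OF p] inK[OF q r] unfolding pseudoforest_def by blast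
qed

text \<open>
  Each edge takes the color of the endpoint that does not represent it. Then a node sees its own
  color and the color of at most one edge, the one that it represents.
\<close>

lemma star_partitioning_number_pseudoforest:
  assumes G: "finite_simple_graph V E" and pf: "pseudoforest V E"
  shows "star_partitioning_number col V E \<le> 2"
proof -
  have "\<forall>e\<in>E. card e = 1 \<or> card e = 2" using finite_simple_graph.edges[OF G] by blast
  then obtain g where g: "inj_on g E" "\<forall>e\<in>E. g e \<in> e"
    using unicyclic_imp_system_of_representatives[OF finite_edges[OF G]
        pseudoforest_imp_unicyclic[OF G pf]] by blast
  define C where "C e = col (the_elem (e - {g e}))" for e
  have C: "C {v, w} = col v" if "{v, w} \<in> E" "g {v, w} = w" for v w
  proof -
    have "{v, w} - {w} = {v}" using edgeD(3)[OF G that(1)] by auto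
    then show ?thesis using that by (simp add: C_def)
  qed
  have other: "\<exists>w. e = {v, w} \<and> g e = w" if "e \<in> E" "v \<in> e" "g e \<noteq> v" for e v
    using edgeE[OF G that(1)] g(2) that by (metis insert_commute insert_iff singletonD)
  have "star_coloring col E C"
    unfolding star_coloring_def
  proof
    fix e assume e: "e \<in> E"
    obtain v where "v \<in> e" "g e \<noteq> v" using edgeE[OF G e] by (metis insertCI)
    then show "\<exists>v\<in>e. C e = col v" using other[OF e] C e by metis
  qed
  moreover have "colors_at E C v \<le> 2" for v
  proof -
    let ?own = "{e \<in> E. g e = v}"
    have fin: "finite ?own" using finite_edges[OF G] by simp
    have "card ?own \<le> 1"
      using g(1) fin by (simp add: card_le_Suc0_iff_eq inj_on_def)
    then have "card (C ` ?own) \<le> 1" using card_image_le[OF fin, of C] by linarith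
    moreover have "{C e |e. e \<in> E \<and> v \<in> e} \<subseteq> insert (col v) (C ` ?own)"
    proof
      fix x assume "x \<in> {C e |e. e \<in> E \<and> v \<in> e}"
      then obtain e where e: "e \<in> E" "v \<in> e" "x = C e" by blast
      show "x \<in> insert (col v) (C ` ?own)"
      proof (cases "g e = v")
        case True
        then show ?thesis using e by simp
      next
        case False
        then obtain w where "e = {v, w}" "g e = w" using other[OF e(1,2)] by blast
        then show ?thesis using C e by simp
      qed
    qed
    then have "colors_at E C v \<le> card (insert (col v) (C ` ?own))"
      unfolding colors_at_def using fin by (intro card_mono) auto
    moreover have "card (insert (col v) (C ` ?own)) \<le> Suc (card (C ` ?own))"
      by (rule card_insert_le_m1) simp_all
    ultimately show ?thesis by linarith
  qed
  ultimately show ?thesis unfolding star_partitioning_number_le_iff[OF G] by blast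
qed

section \<open>Complete bipartite graphs\<close>

text \<open>
  The edges from \<open>v\<close> that have the color of their other end have pairwise different colors. If there
  is an edge with the color of \<open>v\<close> as well, this is one more color, which makes the difference
  between \<open>\<lceil>n / 2\<rceil>\<close> and less than \<open>n / 2\<close>. If there is none, \<open>v\<close> sees \<open>n\<close> colors, too many as \<open>n > 1\<close>.
\<close>

lemma foreign_edges_less_than_half:
  assumes G: "finite_simple_graph V E" and inj: "inj_on col V" and C: "star_coloring col E C"
    and N: "finite N" "card N > 1" "\<And>w. w \<in> N \<Longrightarrow> {v, w} \<in> E"
    and few: "2 * colors_at E C v \<le> card N + 1"
  shows "2 * card {w \<in> N. C {v, w} = col w} < card N"
proof -
  let ?W = "{w \<in> N. C {v, w} = col w}"
  have NV: "N \<subseteq> V" using N(3) edgeD(2)[OF G] by blast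
  have vN: "v \<notin> N" using N(3) edgeD(3)[OF G] by blast
  have injN: "inj_on col N" using inj NV by (rule inj_on_subset)
  have fin: "finite {C e |e. e \<in> E \<and> v \<in> e}" using finite_edges[OF G] by simp
  have cW: "card (col ` ?W) = card ?W" by (rule card_image) (rule inj_on_subset[OF injN], blast)
  have sub: "col ` ?W \<subseteq> {C e |e. e \<in> E \<and> v \<in> e}"
  proof
    fix x assume "x \<in> col ` ?W"
    then obtain w where "w \<in> N" "x = C {v, w}" by force
    then show "x \<in> {C e |e. e \<in> E \<and> v \<in> e}" using N(3) by blast
  qed
  show ?thesis
  proof (cases "?W = N")
    case True
    then have "card N \<le> colors_at E C v"
      using card_mono[OF fin sub] cW by (simp add: colors_at_def)
    then show ?thesis using few N(2) by linarith
  next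
    case False
    then obtain w where w: "w \<in> N" "C {v, w} \<noteq> col w" by blast
    then have own: "C {v, w} = col v" using C N(3)[OF w(1)] by (auto simp: star_coloring_def)
    have "v \<in> V" using edgeD(1)[OF G N(3)[OF w(1)]] .
    then have "col v \<notin> col ` ?W" using inj NV vN by (auto simp: inj_on_def)
    then have "card (insert (col v) (col ` ?W)) = Suc (card ?W)" using cW N(1) by simp
    moreover have "insert (col v) (col ` ?W) \<subseteq> {C e |e. e \<in> E \<and> v \<in> e}"
    proof (rule insert_subsetI[OF _ sub])
      show "col v \<in> {C e |e. e \<in> E \<and> v \<in> e}" using own[symmetric] N(3)[OF w(1)] by blast
    qed
    from card_mono[OF fin this] have "card (insert (col v) (col ` ?W)) \<le> colors_at E C v"
      by (simp add: colors_at_def)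
    ultimately have "Suc (card ?W) \<le> colors_at E C v" by simp
    then show ?thesis using few by linarith
  qed
qed

lemma colors_at_le:
  assumes N: "finite N" "\<And>e. e \<in> E \<Longrightarrow> v \<in> e \<Longrightarrow> C e \<noteq> col v \<Longrightarrow> \<exists>w\<in>N. C e = col w"
  shows "colors_at E C v \<le> Suc (card N)"
proof -
  have "{C e |e. e \<in> E \<and> v \<in> e} \<subseteq> insert (col v) (col ` N)" using N(2) by blast
  then have "colors_at E C v \<le> card (insert (col v) (col ` N))"
    unfolding colors_at_def using N(1) by (intro card_mono) auto
  also have "\<dots> \<le> Suc (card (col ` N))" by (rule card_insert_le_m1) simp_all
  also have "\<dots> \<le> Suc (card N)" using card_image_le[OF N(1)] by simp
  finally show ?thesis .
qed

text \<open>
  Numbers of the same parity are determined by their halves.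
\<close>

lemma card_same_parity_le: "card {j. j < n \<and> even (i + j)} \<le> (n + 1) div 2"
proof -
  let ?S = "{j. j < n \<and> even (i + j)}"
  have "inj_on (\<lambda>j. j div 2) ?S"
  proof (rule inj_onI)
    fix j k assume "j \<in> ?S" "k \<in> ?S" "j div 2 = k div 2"
    then have "j mod 2 = k mod 2" by simp presburger
    then show "j = k" using \<open>j div 2 = k div 2\<close> by (metis div_mult_mod_eq)
  qed
  moreover have "(\<lambda>j. j div 2) ` ?S \<subseteq> {..<(n + 1) div 2}" by auto
  ultimately have "card ?S \<le> card {..<(n + 1) div 2}" by (rule card_inj_on_le) simp
  then show ?thesis by simp
qed

text \<open>
  In the \<open>n \<times> n\<close> chessboard of edges, the black squares belong to the rows and the white ones to the
  columns. Each row and each column contains at most \<open>\<lceil>n / 2\<rceil>\<close> squares of the other owner.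
\<close>

lemma star_partitioning_number_complete_bipartite_le:
  assumes G: "finite_simple_graph V E" and K: "complete_bipartite n n V E"
  shows "star_partitioning_number col V E \<le> (n + 1) div 2 + 1"
proof -
  obtain A B where AB: "finite A" "finite B" "card A = n" "card B = n" "A \<inter> B = {}" "V = A \<union> B"
    "E = {{a, b} | a b. a \<in> A \<and> b \<in> B}" using K unfolding complete_bipartite_def by blast
  obtain f where f: "bij_betw f A {..<n}" using AB ex_bij_betw_finite_nat atLeast0LessThan by metis
  obtain h where h: "bij_betw h B {..<n}" using AB ex_bij_betw_finite_nat atLeast0LessThan by metis
  define C where "C e = (let a = the_elem (e \<inter> A); b = the_elem (e \<inter> B) in
     if even (f a + h b) then col a else col b)" for e
  have C: "C {a, b} = (if even (f a + h b) then col a else col b)" if "a \<in> A" "b \<in> B" for a b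
  proof -
    have "{a, b} \<inter> A = {a}" "{a, b} \<inter> B = {b}" using that AB(5) by auto
    then show ?thesis by (simp add: C_def)
  qed
  have card_le: "card {x \<in> X. even (k + t x)} \<le> (n + 1) div 2"
    if t: "bij_betw t X {..<n}" for t :: "'a \<Rightarrow> nat" and X k
  proof -
    have "inj_on t {x \<in> X. even (k + t x)}"
      using bij_betw_imp_inj_on[OF t] by (rule inj_on_subset) auto
    moreover have "t ` {x \<in> X. even (k + t x)} \<subseteq> {j. j < n \<and> even (k + j)}"
      using bij_betw_imp_surj_on[OF t] by auto
    ultimately have "card {x \<in> X. even (k + t x)} \<le> card {j. j < n \<and> even (k + j)}"
      by (rule card_inj_on_le) simp
    also have "\<dots> \<le> (n + 1) div 2" by (rule card_same_parity_le)
    finally show ?thesis .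
  qed
  have fin: "finite {x \<in> A. P x}" "finite {x \<in> B. P x}" for P using AB by auto
  have "star_coloring col E C"
    unfolding star_coloring_def AB(7) using C by auto
  moreover have "colors_at E C v \<le> (n + 1) div 2 + 1" if "v \<in> V" for v
  proof (cases "v \<in> A")
    case True
    have "colors_at E C v \<le> Suc (card {b \<in> B. even (Suc (f v) + h b)})"
    proof (rule colors_at_le[OF fin(2)])
      fix e assume e: "e \<in> E" "v \<in> e" "C e \<noteq> col v"
      then obtain b where "e = {v, b}" "b \<in> B" using True AB(5,7) by auto
      then show "\<exists>w\<in>{b \<in> B. even (Suc (f v) + h b)}. C e = col w"
        using C[OF True] e(3) by (auto split: if_splits)
    qed
    then show ?thesis using card_le[OF h, of "Suc (f v)"] by linarith
  next
    case False
    then have vB: "v \<in> B" using that AB(6) by blast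
    have "colors_at E C v \<le> Suc (card {a \<in> A. even (h v + f a)})"
    proof (rule colors_at_le[OF fin(1)])
      fix e assume e: "e \<in> E" "v \<in> e" "C e \<noteq> col v"
      then obtain a where "e = {a, v}" "a \<in> A" using vB AB(5,7) by auto
      then show "\<exists>w\<in>{a \<in> A. even (h v + f a)}. C e = col w"
        using C[OF _ vB] e(3) by (auto split: if_splits)
    qed
    then show ?thesis using card_le[OF f, of "h v"] by linarith
  qed
  ultimately show ?thesis unfolding star_partitioning_number_le_iff[OF G] by blast
qed

text \<open>
  Double counting of the pairs of a node and an edge foreign to it: there are at least \<open>n\<^sup>2\<close>, one for
  each edge, but fewer than \<open>n / 2\<close> at each of the \<open>2 n\<close> nodes.
\<close>

lemma star_partitioning_number_complete_bipartite_gt: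
  assumes G: "finite_simple_graph V E" and inj: "inj_on col V"
    and K: "complete_bipartite n n V E" and n: "n > 1"
  shows "star_partitioning_number col V E > (n + 1) div 2"
proof (rule ccontr)
  assume "\<not> ?thesis"
  then have "star_partitioning_number col V E \<le> (n + 1) div 2" by simp
  then obtain C where C: "star_coloring col E C" and le: "\<forall>v\<in>V. colors_at E C v \<le> (n + 1) div 2"
    unfolding star_partitioning_number_le_iff[OF G] by blast
  obtain A B where AB: "finite A" "finite B" "card A = n" "card B = n" "A \<inter> B = {}" "V = A \<union> B"
    "E = {{a, b} | a b. a \<in> A \<and> b \<in> B}" using K unfolding complete_bipartite_def by blast
  have ab: "{a, b} \<in> E" "{b, a} \<in> E" if "a \<in> A" "b \<in> B" for a b
    using that AB(7) by (auto simp: insert_commute)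
  have le2: "2 * colors_at E C v \<le> n + 1" if "v \<in> V" for v using le that by fastforce
  have S: "2 * card {b \<in> B. C {a, b} = col b} < n" if "a \<in> A" for a
    using foreign_edges_less_than_half[OF G inj C AB(2), of a] AB that n ab le2[of a] by auto
  have T: "2 * card {a \<in> A. C {b, a} = col a} < n" if "b \<in> B" for b
    using foreign_edges_less_than_half[OF G inj C AB(1), of b] AB that n ab le2[of b] by auto
  \<comment> \<open>\<open>?s v w\<close> is \<open>1\<close> if the edge between \<open>v\<close> and \<open>w\<close> is foreign to \<open>v\<close>.\<close>
  let ?s = "\<lambda>a b. if C {a, b} = col b then 1 else 0 :: nat"
  have cards: "card {x \<in> X. P x} = (\<Sum>x\<in>X. if P x then 1 else 0)" if "finite X" for X :: "'a set" and P
    using that by (simp add: sum.If_cases Int_def)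
  have "2 * (\<Sum>a\<in>A. \<Sum>b\<in>B. ?s a b) < (\<Sum>a\<in>A. n)"
    unfolding sum_distrib_left[of 2] cards[OF AB(2), symmetric]
    using S AB n by (intro sum_strict_mono) (auto simp: cards)
  moreover have "2 * (\<Sum>b\<in>B. \<Sum>a\<in>A. ?s b a) < (\<Sum>b\<in>B. n)"
    unfolding sum_distrib_left[of 2] cards[OF AB(1), symmetric]
    using T AB n by (intro sum_strict_mono) (auto simp: cards)
  moreover have "(\<Sum>b\<in>B. \<Sum>a\<in>A. ?s b a) = (\<Sum>a\<in>A. \<Sum>b\<in>B. ?s b a)" by (rule sum.swap)
  moreover have "(\<Sum>a\<in>A. \<Sum>b\<in>B. ?s a b) + (\<Sum>a\<in>A. \<Sum>b\<in>B. ?s b a) \<ge> (\<Sum>a\<in>A. \<Sum>b\<in>B. 1)"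
    unfolding sum.distrib[symmetric]
  proof (intro sum_mono)
    fix a b assume "a \<in> A" "b \<in> B"
    then have "C {a, b} = col a \<or> C {a, b} = col b" using C ab by (auto simp: star_coloring_def)
    then show "1 \<le> ?s a b + ?s b a" by (auto simp: insert_commute)
  qed
  ultimately show False using AB by simp
qed

section \<open>The four statements\<close>

theorem lemma1:
  fixes V :: "'a set" and E :: "'a set set" and col :: "'a \<Rightarrow> 'c"
  assumes "finite_simple_graph V E" and "inj_on col V"
  shows "(star_partitioning_number col V E \<ge> 1 \<longleftrightarrow> E \<noteq> {}) \<and>
    (graph_connected V E \<longrightarrow>
      (star_partitioning_number col V E \<le> 1 \<longleftrightarrow> cycle_free V E \<and> diameter V E \<le> 2)) \<and>
    (pseudoforest V E \<longrightarrow> star_partitioning_number col V E \<le> 2) \<and>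
    (\<forall>n::nat. n > 1 \<longrightarrow> complete_bipartite n n V E \<longrightarrow>
      int (star_partitioning_number col V E) = \<lceil>real n / 2\<rceil> + 1)"
proof (intro conjI impI allI)
  fix n :: nat
  assume n: "n > 1" and K: "complete_bipartite n n V E"
  have "star_partitioning_number col V E = (n + 1) div 2 + 1"
    using star_partitioning_number_complete_bipartite_le[OF assms(1) K, of col]
      star_partitioning_number_complete_bipartite_gt[OF assms K n] by linarith
  moreover have "\<lceil>real n / 2\<rceil> = int ((n + 1) div 2)"
    by (rule ceiling_unique; cases "even n") (auto elim!: evenE oddE)
  ultimately show "int (star_partitioning_number col V E) = \<lceil>real n / 2\<rceil> + 1" by simp
qed (use assms star_partitioning_number_ge_1_iff star_partitioning_number_le_1_iff
    star_partitioning_number_pseudoforest in blast)+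

end
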